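(* Let $(\widehat\theta_{k_c})_{k_c\ge\pi}$ be a fixed family of admissible cut-off functions (as defined in the context). Then there exist constants $C_{g,m}$ ($m=0,1,2,\dots$), depending only on $m$ and the constants $C_{\theta,j}$ of the family, and in particular independent of $L$ and $k_c$, such that the following holds. Let $L\ge1$ and let $N\ge 32$ be an even integer with $\Delta x=L/N\le 1$, and set $k_c=\pi/\Delta x$. Let $g\in L^2(\mathcal{X})$ be the inverse discrete Fourier transform of $\widehat g$ defined by $$(1+\widehat h_k)\,\widehat g_k=-1,\qquad k\in\mathcal{K}.$$ Then for all integers $0\le m\le M=\frac{N}{16}$, $$\|d(\cdot,0)^m g\|_{2}\le C_{g,m}.$$
   Context: Grids: for $L>0$ and an even positive integer $N$, $\Delta x=L/N$, $\mathcal{X}=\{i\Delta x:i=0,\dots,N-1\}$, $\Delta k=2\pi/L$, $\mathcal{K}=\{n\Delta k: n=-\frac N2+1,\dots,\frac N2\}$, $k_c=\frac N2\Delta k=\pi/\Delta x$ (so $k_c\ge\pi$ when $\Delta x\le1$). For lattice functions $\|f\|_2^2=\|f\|_{L^2(\mathcal X)}^2=\Delta x\sum_{x\in\mathcal{X}}|f(x)|^2$. Discrete Fourier transform: $\widehat f_k=\Delta x\sum_{x\in\mathcal{X}}e^{-\mathrm{i}kx}f(x)$, $k\in\mathcal{K}$, with inverse $f(x)=\frac1L\sum_{k\in\mathcal{K}}e^{\mathrm{i}kx}\widehat f_k$, $x\in\mathcal{X}$. Distance: $d(x,0)=x$ for $x\in[0,L/2)$ and $d(x,0)=L-x$ for $x\in[L/2,L)$.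 Admissible family of cut-offs: for each $k_c\ge\pi$ a function $\widehat\theta=\widehat\theta_{k_c}\in C^\infty(\mathbb{R})$ with $0\le\widehat\theta\le1$, $\widehat\theta(k)=1$ for $|k|\le\frac12k_c$, $\widehat\theta(k)=0$ for $|k|\ge\frac34k_c$, such that for each integer $m\ge0$ there is a constant $C_{\theta,m}$ independent of $k_c$ with $\sup_{k\in\mathbb{R}}\bigl|\frac{\mathrm d^m\widehat\theta}{\mathrm dk^m}(k)\bigr|\le C_{\theta,m}$. Mollified Laplacian symbol: $\widehat h(k)=\widehat\theta(k)(k^2-k_c^2)+k_c^2$ and $\widehat h_k=\widehat h(k)$ for $k\in\mathcal{K}$. *)

theory Defs
  imports "HOL-Analysis.Analysis"
begin

definition smooth :: "(real \<Rightarrow> real) \<Rightarrow> bool" where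
  "smooth f \<longleftrightarrow> (\<forall>m x. (deriv ^^ m) f differentiable (at x))"

(* N is used only for even positive values, so that N div 2 = N/2. *)

definition dx :: "real \<Rightarrow> nat \<Rightarrow> real" where
  "dx L N = L / real N"

definition dk :: "real \<Rightarrow> real" where
  "dk L = 2 * pi / L"

definition space_grid :: "real \<Rightarrow> nat \<Rightarrow> real set" where
  "space_grid L N = (\<lambda>i. real i * dx L N) ` {0..<N}"

definition freq_grid :: "real \<Rightarrow> nat \<Rightarrow> real set" where
  "freq_grid L N = (\<lambda>n. of_int n * dk L) ` {- int (N div 2) + 1 .. int (N div 2)}"

definition cutoff_freq :: "real \<Rightarrow> nat \<Rightarrow> real" where
  "cutoff_freq L N = pi / dx L N"

(* A lattice function is represented by a function on the reals, of which only the
   values on space_grid L N (resp. freq_grid L N) are ever used. *)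

definition lattice_norm :: "real \<Rightarrow> nat \<Rightarrow> (real \<Rightarrow> complex) \<Rightarrow> real" where
  "lattice_norm L N f = sqrt (dx L N * (\<Sum>x\<in>space_grid L N. (cmod (f x))\<^sup>2))"

definition inverse_dft :: "real \<Rightarrow> nat \<Rightarrow> (real \<Rightarrow> complex) \<Rightarrow> real \<Rightarrow> complex" where
  "inverse_dft L N fhat x =
     1 / of_real L * (\<Sum>k\<in>freq_grid L N. exp (\<i> * of_real (k * x)) * fhat k)"

(* Distance to 0 on the circle of length L; meant for x in [0, L). *)

definition dist0 :: "real \<Rightarrow> real \<Rightarrow> real" where
  "dist0 L x = (if x < L / 2 then x else L - x)"

(* theta kc is the cut-off function for the parameter kc; C m bounds all m-th
   derivatives uniformly in kc. Values theta kc with kc < pi are unconstrained. *)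

definition admissible_cutoffs :: "(nat \<Rightarrow> real) \<Rightarrow> (real \<Rightarrow> real \<Rightarrow> real) \<Rightarrow> bool" where
  "admissible_cutoffs C \<theta> \<longleftrightarrow>
     (\<forall>kc\<ge>pi.
        smooth (\<theta> kc) \<and>
        (\<forall>k. 0 \<le> \<theta> kc k \<and> \<theta> kc k \<le> 1) \<and>
        (\<forall>k. \<bar>k\<bar> \<le> 1/2 * kc \<longrightarrow> \<theta> kc k = 1) \<and>
        (\<forall>k. \<bar>k\<bar> \<ge> 3/4 * kc \<longrightarrow> \<theta> kc k = 0) \<and>
        (\<forall>m k. \<bar>(deriv ^^ m) (\<theta> kc) k\<bar> \<le> C m))"

definition mollified_symbol :: "(real \<Rightarrow> real \<Rightarrow> real) \<Rightarrow> real \<Rightarrow> real \<Rightarrow> real" where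
  "mollified_symbol \<theta> kc k = \<theta> kc k * (k\<^sup>2 - kc\<^sup>2) + kc\<^sup>2"

end

theory Submission
  imports Defs
begin

text \<open>
  Multiplication by the distance is dominated by multiplication by
  \<open>L / 4 * \<bar>cis (- dk * x) - 1\<bar>\<close>, which on the Fourier side is a forward difference with step
  \<open>dk = 2 * pi / L\<close>. The boundary terms of the summation by parts vanish as long as \<open>m \<le> N / 16\<close>,
  because the symbol is constant for \<open>\<bar>k\<bar> \<ge> 3/4 * kc\<close>. By Parseval it remains to bound the \<open>m\<close>-th
  differences, hence the \<open>m\<close>-th derivative, of \<open>1 / H\<close> where \<open>H = 1 + h\<close> is the shifted mollified
  symbol. Every derivative of \<open>H\<close> is bounded by a multiple of \<open>H\<close> itself, uniformly in \<open>kc\<close>: the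
  derivatives of the cut-off live on \<open>kc/2 \<le> \<bar>k\<bar> \<le> 3/4 * kc\<close>, where \<open>kc\<close> and \<open>k\<close> are comparable. The
  Leibniz rule for \<open>H * (1 / H) = 1\<close> then bounds every derivative of \<open>1 / H\<close> by a multiple of \<open>1 / H\<close>,
  which is square summable uniformly in \<open>L\<close>.
\<close>

unbundle no vec_syntax
unbundle fps_syntax

section \<open>Jets\<close>

text \<open>A smooth function is represented by its Taylor series at every point. The Leibniz rule then
  becomes the multiplication of formal power series.\<close>

definition is_jet :: "(real \<Rightarrow> real fps) \<Rightarrow> bool" where
  "is_jet P \<longleftrightarrow>
     (\<forall>n x. ((\<lambda>y. P y $ n) has_real_derivative fps_deriv (P x) $ n) (at x))"

text \<open>\<open>P'\<close> and \<open>Q'\<close> are arbitrary coefficientwise derivatives, not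
  \<open>fps_deriv\<close>: in \<open>is_jet_inverse\<close> the product rule is applied to a factor
  not yet known to be a jet.\<close>

lemma fps_mult_has_derivative:
  fixes P Q :: "real \<Rightarrow> real fps"
  assumes "\<And>i. ((\<lambda>y. P y $ i) has_real_derivative P' $ i) (at x)"
    and "\<And>i. ((\<lambda>y. Q y $ i) has_real_derivative Q' $ i) (at x)"
  shows "((\<lambda>y. (P y * Q y) $ n) has_real_derivative (P' * Q x + P x * Q') $ n) (at x)"
  unfolding fps_add_nth fps_mult_nth
  by (rule derivative_eq_intros refl assms)+ (simp add: sum.distrib algebra_simps)

lemma is_jet_const: "is_jet (\<lambda>x. fps_const c)"
  by (simp add: is_jet_def)

lemma is_jet_ident: "is_jet (\<lambda>x. fps_const x + fps_X)"
  by (auto simp: is_jet_def fps_X_def intro!: derivative_eq_intros)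

lemma is_jet_add: "is_jet P \<Longrightarrow> is_jet Q \<Longrightarrow> is_jet (\<lambda>x. P x + Q x)"
  by (auto simp: is_jet_def ring_distribs intro!: derivative_eq_intros)

lemma is_jet_diff: "is_jet P \<Longrightarrow> is_jet Q \<Longrightarrow> is_jet (\<lambda>x. P x - Q x)"
  by (auto simp: is_jet_def ring_distribs intro!: derivative_eq_intros)

lemma is_jet_mult:
  assumes "is_jet P" "is_jet Q" shows "is_jet (\<lambda>x. P x * Q x)"
  using fps_mult_has_derivative[of P "fps_deriv (P x)" x Q "fps_deriv (Q x)" for x] assms
  by (simp add: is_jet_def add.commute)

lemma is_jet_shift:
  assumes "is_jet P" shows "is_jet (\<lambda>x. P (x + h))"
  unfolding is_jet_def
proof (intro allI)
  fix n x
  have "((\<lambda>y. P y $ n) has_real_derivative fps_deriv (P (x + h)) $ n) (at (x + h))"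
    using assms by (simp add: is_jet_def)
  then show "((\<lambda>y. P (y + h) $ n) has_real_derivative fps_deriv (P (x + h)) $ n) (at x)"
    by (simp add: DERIV_shift)
qed

text \<open>The recursion for the coefficients of a reciprocal shows that they are differentiable.
  Differentiating \<open>P x * I x = 1\<close> coefficientwise then determines the derivative
  \<open>D\<close> as \<open>- fps_deriv (P x) * (I x)^2\<close>, which is the formal derivative of
  \<open>I x\<close>.\<close>

lemma is_jet_inverse:
  assumes P: "is_jet P" and nz: "\<And>x. P x $ 0 \<noteq> 0"
  shows "is_jet (\<lambda>x. inverse (P x))"
proof -
  define I where "I x = inverse (P x)" for x
  have PI: "P x * I x = 1" for x
    using nz by (simp add: I_def inverse_mult_eq_1')
  have rec: "I x $ n = - inverse (P x $ 0) * (\<Sum>i=1..n. P x $ i * I x $ (n - i))"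
    if "n > 0" for n x
  proof -
    have "0 = (P x * I x) $ n" using PI that by simp
    also have "\<dots> = P x $ 0 * I x $ n + (\<Sum>i=1..n. P x $ i * I x $ (n - i))"
      by (simp add: fps_mult_nth sum.atLeast_Suc_atMost)
    finally show ?thesis using nz[of x] by (simp add: field_simps)
  qed
  have dP: "(\<lambda>y. P y $ i) differentiable (at x)" for i x
    using P by (auto simp: is_jet_def real_differentiable_def)
  have dI: "(\<lambda>y. I y $ n) differentiable (at x)" for n x
  proof (induction n rule: less_induct)
    case (less n)
    show ?case
    proof (cases "n = 0")
      case True
      then show ?thesis using nz dP by (auto simp: I_def intro!: derivative_intros)
    next
      case False
      have "(\<lambda>y. - inverse (P y $ 0) * (\<Sum>i=1..n. P y $ i * I y $ (n - i))) differentiable (at x)"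
        using nz dP less by (auto intro!: derivative_intros)
      then show ?thesis using rec False by simp
    qed
  qed
  have "fps_deriv (I x) $ n = deriv (\<lambda>y. I y $ n) x" for n x
  proof -
    define D where "D = Abs_fps (\<lambda>n. deriv (\<lambda>y. I y $ n) x)"
    have D: "((\<lambda>y. I y $ i) has_real_derivative D $ i) (at x)" for i
      using dI by (simp add: D_def DERIV_deriv_iff_real_differentiable)
    have "(fps_deriv (P x) * I x + P x * D) $ n = 0" for n
    proof (rule DERIV_unique)
      show "((\<lambda>y. (P y * I y) $ n) has_real_derivative
          (fps_deriv (P x) * I x + P x * D) $ n) (at x)"
        using P D by (intro fps_mult_has_derivative) (auto simp: is_jet_def)
      show "((\<lambda>y. (P y * I y) $ n) has_real_derivative 0) (at x)"
        by (simp add: PI)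
    qed
    then have "fps_deriv (P x) * I x + P x * D = 0"
      by (simp add: fps_eq_iff)
    then have "I x * (fps_deriv (P x) * I x + P x * D) = 0" by simp
    then have "fps_deriv (P x) * (I x)\<^sup>2 + P x * I x * D = 0"
      by (simp add: algebra_simps power2_eq_square)
    then have "D = - (fps_deriv (P x) * (I x)\<^sup>2)"
      unfolding PI mult_1 by (metis add_eq_0_iff)
    then have "D = fps_deriv (I x)"
      using fps_inverse_deriv[OF nz] by (simp add: I_def)
    then have "fps_deriv (I x) $ n = D $ n" by simp
    then show ?thesis by (simp only: D_def fps_nth_Abs_fps)
  qed
  then show ?thesis
    using dI by (simp add: is_jet_def DERIV_deriv_iff_real_differentiable flip: I_def)
qed

text \<open>The recursion for the coefficients of a reciprocal with absolute values taken:
  \<open>A i\<close> stands for the size of the \<open>i\<close>-th coefficient relative to the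
  constant one.\<close>

fun inverse_bound :: "(nat \<Rightarrow> real) \<Rightarrow> nat \<Rightarrow> real" where
  "inverse_bound A 0 = 1"
| "inverse_bound A (Suc n) = (\<Sum>i=1..Suc n. A i * inverse_bound A (Suc n - i))"

text \<open>Solve the \<open>n\<close>-th coefficient of \<open>H * inverse H = 1\<close> for
  \<open>inverse H $ n\<close>. In each product the factor \<open>H $ 0\<close> from the hypothesis
  cancels the \<open>1 / H $ 0\<close> from the induction, so the constant depends on
  \<open>A\<close> alone.\<close>

lemma abs_fps_inverse_nth_le:
  fixes H :: "real fps"
  assumes "H $ 0 > 0" and "\<And>i. i > 0 \<Longrightarrow> \<bar>H $ i\<bar> \<le> A i * H $ 0"
  shows "\<bar>inverse H $ n\<bar> \<le> inverse_bound A n / H $ 0"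
proof (induction n rule: less_induct)
  case (less n)
  show ?case
  proof (cases n)
    case 0
    then show ?thesis using assms(1) by (simp add: inverse_eq_divide)
  next
    case (Suc k)
    have "0 = (H * inverse H) $ n"
      using assms(1) Suc by (simp add: inverse_mult_eq_1')
    also have "\<dots> = H $ 0 * inverse H $ n + (\<Sum>i=1..n. H $ i * inverse H $ (n - i))"
      by (simp add: fps_mult_nth sum.atLeast_Suc_atMost)
    finally have "\<bar>H $ 0 * inverse H $ n\<bar> = \<bar>\<Sum>i=1..n. H $ i * inverse H $ (n - i)\<bar>"
      by linarith
    then have "H $ 0 * \<bar>inverse H $ n\<bar> = \<bar>\<Sum>i=1..n. H $ i * inverse H $ (n - i)\<bar>"
      using assms(1) by (simp add: abs_mult)
    also have "\<dots> \<le> (\<Sum>i=1..n. (A i * H $ 0) * (inverse_bound A (n - i) / H $ 0))"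
    proof (rule order.trans[OF sum_abs sum_mono])
      fix i assume "i \<in> {1..n}"
      then have "\<bar>H $ i\<bar> \<le> A i * H $ 0"
        and "\<bar>inverse H $ (n - i)\<bar> \<le> inverse_bound A (n - i) / H $ 0"
        using assms(2) less by auto
      then show "\<bar>H $ i * inverse H $ (n - i)\<bar> \<le>
          A i * H $ 0 * (inverse_bound A (n - i) / H $ 0)"
        unfolding abs_mult using abs_ge_zero by (meson mult_mono order.trans)
    qed
    also have "\<dots> = inverse_bound A n"
      using assms(1) Suc by simp
    finally show ?thesis using assms(1) by (simp add: field_simps)
  qed
qed

section \<open>Finite differences\<close>

definition fdiff :: "real \<Rightarrow> (real \<Rightarrow> real) \<Rightarrow> real \<Rightarrow> real" where
  "fdiff h f x = f (x + h) - f x"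

lemma funpow_fdiff_Suc: "(fdiff h ^^ Suc m) f x = (fdiff h ^^ m) f (x + h) - (fdiff h ^^ m) f x"
  by (simp add: fdiff_def)

text \<open>The \<open>m\<close>-th difference samples \<open>f\<close> only between
  \<open>x\<close> and \<open>x + m * h\<close>. This evaluates the boundary values in the summation
  by parts.\<close>

lemma funpow_fdiff_const:
  assumes "h \<ge> 0" and "\<And>y. x \<le> y \<Longrightarrow> y \<le> x + m * h \<Longrightarrow> f y = c"
  shows "(fdiff h ^^ m) f x = (if m = 0 then c else 0)"
  using assms(2)
proof (induction m arbitrary: x)
  case (Suc m)
  have "(fdiff h ^^ m) f (x + h) = (if m = 0 then c else 0)"
    using assms(1) by (intro Suc) (auto simp: algebra_simps)
  moreover have "(fdiff h ^^ m) f x = (if m = 0 then c else 0)"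
    using assms(1) by (intro Suc) (auto simp: algebra_simps)
  ultimately show ?case by (simp add: funpow_fdiff_Suc del: funpow.simps)
qed auto

text \<open>One difference is moved into the jet, giving \<open>Q\<close>. The mean value inequality
  bounds \<open>Q y $ m\<close> through the derivative of \<open>P y $ m\<close>, which is
  \<open>Suc m\<close> times the next coefficient. These factors build up \<open>fact m\<close>, as
  coefficients are derivatives divided by factorials.\<close>

lemma abs_funpow_fdiff_le:
  assumes "is_jet P" "h \<ge> 0" "\<And>y. x \<le> y \<Longrightarrow> y \<le> x + m * h \<Longrightarrow> \<bar>P y $ m\<bar> \<le> B"
  shows "\<bar>(fdiff h ^^ m) (\<lambda>y. P y $ 0) x\<bar> \<le> h ^ m * fact m * B"
  using assms(1,3)
proof (induction m arbitrary: P B)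
  case (Suc m)
  define Q where "Q y = P (y + h) - P y" for y
  have Q: "is_jet Q"
    using Suc.prems(1) unfolding Q_def by (intro is_jet_diff is_jet_shift)
  have "\<bar>Q y $ m\<bar> \<le> h * (real (Suc m) * B)" if y: "x \<le> y" "y \<le> x + m * h" for y
  proof -
    have "norm (P (y + h) $ m - P y $ m) \<le> (real (Suc m) * B) * norm (y + h - y)"
    proof (rule field_differentiable_bound)
      show "convex {y..y + h}" by simp
      fix z assume z: "z \<in> {y..y + h}"
      show "((\<lambda>y. P y $ m) has_field_derivative fps_deriv (P z) $ m) (at z within {y..y + h})"
        using Suc.prems(1) by (auto simp: is_jet_def intro: has_field_derivative_at_within)
      have "\<bar>P z $ Suc m\<bar> \<le> B"
        using z y by (intro Suc.prems(2)) (auto simp: algebra_simps)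
      then have "real (Suc m) * \<bar>P z $ Suc m\<bar> \<le> real (Suc m) * B"
        by (rule mult_left_mono) simp
      then show "norm (fps_deriv (P z) $ m) \<le> real (Suc m) * B"
        by (simp add: abs_mult)
    qed (use assms(2) in auto)
    then show ?thesis using assms(2) by (simp add: Q_def mult.commute)
  qed
  then have "\<bar>(fdiff h ^^ m) (\<lambda>y. Q y $ 0) x\<bar> \<le> h ^ m * fact m * (h * (real (Suc m) * B))"
    by (rule Suc.IH[OF Q])
  moreover have "(fdiff h ^^ Suc m) (\<lambda>y. P y $ 0) = (fdiff h ^^ m) (\<lambda>y. Q y $ 0)"
    by (simp add: funpow_Suc_right fdiff_def[abs_def] Q_def del: funpow.simps)
  ultimately show ?case by (simp only: fact_Suc power_Suc of_nat_mult mult_ac)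
qed auto

section \<open>Trigonometric sums\<close>

text \<open>By concavity, sine lies above its chord from 0 to \<open>pi / 2\<close>.\<close>

lemma sin_ge_chord:
  fixes u :: real
  assumes "0 \<le> u" "u \<le> pi / 2"
  shows "2 * u / pi \<le> sin u"
proof -
  have "convex_on {0..pi} (\<lambda>x. - sin x :: real)"
    by (rule f''_ge0_imp_convex[where f' = "\<lambda>x. - cos x" and f'' = sin])
      (auto intro!: derivative_eq_intros sin_ge_zero)
  from convex_onD[OF this, of "2 * u / pi" 0 "pi / 2"] assms
  show ?thesis by (auto simp: divide_simps)
qed

text \<open>A full geometric sum whose ratio is an \<open>N\<close>-th root of unity different from
  1.\<close>

lemma sum_cis_eq_0:
  fixes d :: int
  assumes "N > 0" "\<not> int N dvd d"
  shows "(\<Sum>i<N. cis (2 * pi * d * real i / N)) = 0"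
proof -
  define w where "w = cis (2 * pi * d / N)"
  have pow: "w ^ i = cis (2 * pi * d * real i / N)" for i
    unfolding w_def Complex.DeMoivre by (simp add: mult_ac)
  have "w \<noteq> 1"
  proof
    assume "w = 1"
    then have "cos (2 * pi * d / N) = 1" by (simp add: w_def complex_eq_iff)
    then obtain k :: int where "2 * pi * d / N = k * 2 * pi"
      by (auto simp: cos_one_2pi_int)
    then have "real_of_int d = k * N" using assms(1) by (simp add: field_simps)
    then have "d = k * int N" by (metis of_int_eq_iff of_int_mult of_int_of_nat_eq)
    then show False using assms(2) by simp
  qed
  moreover have "w ^ N = 1"
    using assms(1) cis_multiple_2pi[of "of_int d"] by (simp add: pow)
  ultimately show ?thesis by (simp add: sum_gp_strict flip: pow)
qed

text \<open>Expand the squared modulus into a double sum over frequencies. Distinct frequencies in a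
  window of \<open>N\<close> consecutive integers differ by a non-multiple of \<open>N\<close>, so
  only the diagonal survives.\<close>

lemma discrete_parseval:
  fixes F :: "int \<Rightarrow> complex"
  assumes "N > 0"
  shows "(\<Sum>i<N. (cmod (\<Sum>n\<in>{a..<a + int N}. cis (2 * pi * n * real i / N) * F n))\<^sup>2)
    = N * (\<Sum>n\<in>{a..<a + int N}. (cmod (F n))\<^sup>2)"
proof -
  let ?A = "{a..<a + int N}"
  let ?e = "\<lambda>n i :: nat. cis (2 * pi * of_int n * i / N)"
  have orth: "(\<Sum>i<N. ?e (n - l) i) = (if l = n then of_nat N else 0)"
    if "n \<in> ?A" "l \<in> ?A" for n l
  proof (cases "l = n")
    case False
    have "\<bar>n - l\<bar> < int N" using that by auto
    then have "\<not> int N dvd n - l"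
      using False zdvd_not_zless[of "\<bar>n - l\<bar>" "int N"] by auto
    then show ?thesis using sum_cis_eq_0[OF assms, of "n - l"] False by simp
  qed simp
  have "complex_of_real (\<Sum>i<N. (cmod (\<Sum>n\<in>?A. ?e n i * F n))\<^sup>2)
      = (\<Sum>i<N. \<Sum>n\<in>?A. \<Sum>l\<in>?A. (?e n i * F n) * cnj (?e l i * F l))"
    by (simp add: complex_norm_square sum_product flip: of_real_power del: complex_cnj_mult)
  also have "\<dots> = (\<Sum>i<N. \<Sum>n\<in>?A. \<Sum>l\<in>?A. ?e (n - l) i * (F n * cnj (F l)))"
  proof (intro sum.cong refl)
    fix i n l
    have "?e n i * cnj (?e l i) = ?e (n - l) i"
      by (simp add: cis_cnj cis_mult ring_distribs diff_divide_distrib)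
    then show "(?e n i * F n) * cnj (?e l i * F l) = ?e (n - l) i * (F n * cnj (F l))"
      by (simp add: mult_ac flip: \<open>?e n i * cnj (?e l i) = ?e (n - l) i\<close>)
  qed
  also have "\<dots> = (\<Sum>n\<in>?A. \<Sum>l\<in>?A. (\<Sum>i<N. ?e (n - l) i) * (F n * cnj (F l)))"
    by (simp add: sum.swap[where A = "{..<N}"] sum_distrib_right)
  also have "\<dots> = (\<Sum>n\<in>?A. \<Sum>l\<in>?A. if l = n then of_nat N * (F n * cnj (F l)) else 0)"
    by (intro sum.cong refl, subst orth) auto
  also have "\<dots> = (\<Sum>n\<in>?A. of_nat N * (F n * cnj (F n)))"
    by (intro sum.cong refl) simp
  also have "\<dots> = complex_of_real (N * (\<Sum>n\<in>?A. (cmod (F n))\<^sup>2))"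
    by (simp add: complex_norm_square sum_distrib_left flip: of_real_power)
  finally show ?thesis by (simp only: of_real_eq_iff)
qed

text \<open>Multiplication by \<open>cis (- t)\<close> shifts the phase by one index. Moving the
  window by one exchanges the term at \<open>a\<close> for the one at \<open>a + int N\<close>; the
  two hypotheses make these equal.\<close>

lemma summation_by_parts_cis:
  fixes F :: "int \<Rightarrow> complex" and t :: real
  assumes "cis (N * t) = 1" "F (a + int N) = F a"
  shows "(cis (- t) - 1) * (\<Sum>n\<in>{a..<a + int N}. cis (n * t) * F n)
    = (\<Sum>n\<in>{a..<a + int N}. cis (n * t) * (F (n + 1) - F n))"
proof -
  define u where "u n = cis ((of_int n - 1) * t) * F n" for n
  have "sum u {a..<a + int N} = sum u {a + 1..<a + 1 + int N}"
  proof (cases "N = 0")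
    case False
    have "(of_int (a + int N) - 1) * t = (of_int a - 1) * t + N * t"
      by (simp add: algebra_simps)
    then have "u (a + int N) = u a" using assms by (simp add: u_def flip: cis_mult)
    moreover have "{a..<a + int N} = insert a {a + 1..<a + int N}"
      "{a + 1..<a + 1 + int N} = insert (a + int N) {a + 1..<a + int N}"
      using False by auto
    ultimately show ?thesis by simp
  qed simp
  also have "\<dots> = (\<Sum>n\<in>{a..<a + int N}. u (n + 1))"
    by (rule sum.reindex_bij_witness[of _ "\<lambda>n. n + 1" "\<lambda>n. n - 1"]) auto
  also have "\<dots> = (\<Sum>n\<in>{a..<a + int N}. cis (n * t) * F (n + 1))"
    by (simp add: u_def)
  finally have "sum u {a..<a + int N} = (\<Sum>n\<in>{a..<a + int N}. cis (n * t) * F (n + 1))" .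
  moreover have "u n = cis (- t) * (cis (n * t) * F n)" for n
    by (simp add: u_def cis_mult left_diff_distrib flip: mult.assoc)
  ultimately show ?thesis
    by (simp add: left_diff_distrib right_diff_distrib sum_subtractf flip: sum_distrib_left)
qed

text \<open>Riemann sum of \<open>1 / (1 + x^2)\<close> with mesh \<open>a\<close>: since the
  integrand decreases away from 0, each term with nonzero \<open>n\<close> is at most an increment
  of \<open>arctan\<close>. The term at 0 contributes the extra \<open>a\<close>.\<close>

lemma sum_le_arctan:
  assumes "a > 0"
  shows "(\<Sum>n\<in>{- int K..int K}. a / (1 + (of_int n * a)\<^sup>2)) \<le> a + 2 * arctan (K * a)"
proof (induction K)
  case (Suc K)
  define f where "f n = a / (1 + (of_int n * a)\<^sup>2)" for n :: int
  have "{- int (Suc K)..int (Suc K)} =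
      insert (int (Suc K)) (insert (- int (Suc K)) {- int K..int K})"
    by auto
  then have "sum f {- int (Suc K)..int (Suc K)} =
      f (int (Suc K)) + (f (- int (Suc K)) + sum f {- int K..int K})"
    by simp
  also have "f (- int (Suc K)) = f (int (Suc K))"
    by (simp add: f_def power2_eq_square algebra_simps)
  finally have eq: "sum f {- int (Suc K)..int (Suc K)} =
      2 * f (int (Suc K)) + sum f {- int K..int K}"
    by simp
  obtain z where z: "K * a < z" "z < Suc K * a"
    "arctan (Suc K * a) - arctan (K * a) = (Suc K * a - K * a) * inverse (1 + z\<^sup>2)"
    using MVT2[of "K * a" "Suc K * a" arctan "\<lambda>x. inverse (1 + x\<^sup>2)"] assms
    by (auto simp: DERIV_arctan)
  have "0 \<le> z" using z(1) assms by (smt (verit) mult_nonneg_nonneg of_nat_0_le_iff)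
  then have "z\<^sup>2 \<le> (Suc K * a)\<^sup>2" using z(2) by (intro power_mono) auto
  then have "inverse (1 + (Suc K * a)\<^sup>2) \<le> inverse (1 + z\<^sup>2)"
    by (intro le_imp_inverse_le) (auto intro: add_pos_nonneg)
  then have "a * inverse (1 + (Suc K * a)\<^sup>2) \<le> a * inverse (1 + z\<^sup>2)"
    using assms by (intro mult_left_mono) auto
  then have "f (int (Suc K)) \<le> arctan (Suc K * a) - arctan (K * a)"
    unfolding z(3) by (simp add: f_def divide_inverse algebra_simps)
  then show ?case using Suc eq unfolding f_def by linarith
qed simp

section \<open>The mollified symbol\<close>

definition taylor :: "(real \<Rightarrow> real) \<Rightarrow> real \<Rightarrow> real fps" where
  "taylor f x = Abs_fps (\<lambda>n. (deriv ^^ n) f x / fact n)"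

lemma is_jet_taylor:
  assumes "smooth f" shows "is_jet (taylor f)"
  unfolding is_jet_def
proof (intro allI)
  fix n x
  have "((deriv ^^ n) f has_real_derivative (deriv ^^ Suc n) f x) (at x)"
    using assms by (simp add: smooth_def DERIV_deriv_iff_real_differentiable)
  then have "((\<lambda>y. (deriv ^^ n) f y / fact n) has_real_derivative (deriv ^^ Suc n) f x / fact n) (at x)"
    by (rule DERIV_cdivide)
  moreover have "fps_deriv (taylor f x) $ n = (deriv ^^ Suc n) f x / fact n"
    by (simp add: taylor_def del: of_nat_Suc funpow.simps)
  moreover have "(\<lambda>y. taylor f y $ n) = (\<lambda>y. (deriv ^^ n) f y / fact n)"
    by (simp add: taylor_def)
  ultimately show "((\<lambda>y. taylor f y $ n) has_real_derivative fps_deriv (taylor f x) $ n) (at x)"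
    by metis
qed

lemma higher_deriv_const_on_open:
  fixes f :: "real \<Rightarrow> real"
  assumes "open S" "\<And>y. y \<in> S \<Longrightarrow> f y = c" "x \<in> S"
  shows "(deriv ^^ n) f x = (if n = 0 then c else 0)"
  using assms(3)
proof (induction n arbitrary: x)
  case (Suc n)
  have "deriv ((deriv ^^ n) f) x = deriv (\<lambda>_. if n = 0 then c else 0) x"
    using Suc by (intro deriv_cong_ev eventually_mono[OF eventually_nhds_in_open[OF assms(1)]]) auto
  then show ?case by simp
qed (use assms(2) in auto)

text \<open>One summand for each term of \<open>H_nth_Suc\<close>. At \<open>n = 1\<close> the index
  \<open>n - 2\<close> truncates to 0, which only enlarges the bound, by
  \<open>C_nonneg\<close>.\<close>

definition symbol_bound :: "(nat \<Rightarrow> real) \<Rightarrow> nat \<Rightarrow> real" where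
  "symbol_bound C n = 3 * C n + C (n - 1) + C (n - 2)"

locale cutoff =
  fixes C :: "nat \<Rightarrow> real" and \<theta> :: "real \<Rightarrow> real \<Rightarrow> real" and kc :: real
  assumes admissible: "admissible_cutoffs C \<theta>" and kc_ge: "pi \<le> kc"
begin

lemma kc_pos: "0 < kc"
  using kc_ge pi_gt_zero by linarith

lemma
  shows smooth_cutoff: "smooth (\<theta> kc)"
    and cutoff_nonneg: "0 \<le> \<theta> kc k"
    and cutoff_le_1: "\<theta> kc k \<le> 1"
    and cutoff_eq_1: "\<bar>k\<bar> \<le> kc / 2 \<Longrightarrow> \<theta> kc k = 1"
    and cutoff_eq_0: "3 / 4 * kc \<le> \<bar>k\<bar> \<Longrightarrow> \<theta> kc k = 0"
    and abs_deriv_cutoff_le: "\<bar>(deriv ^^ n) (\<theta> kc) k\<bar> \<le> C n"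
  using admissible kc_ge by (auto simp: admissible_cutoffs_def)

lemma C_nonneg: "0 \<le> C n"
  using abs_deriv_cutoff_le[of n 0] by linarith

abbreviation T :: "real \<Rightarrow> real fps" where "T \<equiv> taylor (\<theta> kc)"

lemma abs_T_le: "\<bar>T k $ n\<bar> \<le> C n"
proof -
  have "\<bar>(deriv ^^ n) (\<theta> kc) k\<bar> / fact n \<le> C n / 1"
    using abs_deriv_cutoff_le C_nonneg by (intro frac_le) (auto simp: fact_ge_1)
  then show ?thesis by (simp add: taylor_def)
qed

text \<open>The strict inequality puts \<open>k\<close> in an open set on which the cut-off is
  constant, so that all derivatives vanish there too.\<close>

lemma T_eq_0_outer: "T k $ n = 0" if "3 / 4 * kc < \<bar>k\<bar>"
proof -
  have "open {y :: real. 3 / 4 * kc < \<bar>y\<bar>}"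
    by (intro open_Collect_less continuous_intros)
  from higher_deriv_const_on_open[OF this, of "\<theta> kc" 0 k n] that
  show ?thesis by (simp add: taylor_def cutoff_eq_0)
qed

lemma T_eq_0_inner: "T k $ n = 0" if "\<bar>k\<bar> < kc / 2" "n > 0"
proof -
  have "open {y :: real. \<bar>y\<bar> < kc / 2}"
    by (intro open_Collect_less continuous_intros)
  from higher_deriv_const_on_open[OF this, of "\<theta> kc" 1 k n] that
  show ?thesis by (simp add: taylor_def cutoff_eq_1)
qed

text \<open>The Taylor series at \<open>k\<close> of 1 plus the mollified symbol: the variable is
  replaced by its own series \<open>fps_const k + fps_X\<close>.\<close>

definition H :: "real \<Rightarrow> real fps" where
  "H k = 1 + T k * ((fps_const k + fps_X)\<^sup>2 - fps_const (kc\<^sup>2)) + fps_const (kc\<^sup>2)"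

lemma H_nth_0: "H k $ 0 = 1 + mollified_symbol \<theta> kc k"
  by (simp add: H_def mollified_symbol_def taylor_def power2_eq_square)

text \<open>The polynomial factor is \<open>(k^2 - kc^2) + 2 * k * X + X^2\<close>, so at most three
  coefficients of the cut-off contribute.\<close>

lemma H_nth_Suc: "H k $ Suc n = T k $ Suc n * (k\<^sup>2 - kc\<^sup>2) + T k $ n * (2 * k)
    + (if n = 0 then 0 else T k $ (n - 1))"
proof -
  have "H k = 1 + fps_const (kc\<^sup>2) + T k * fps_const (k\<^sup>2 - kc\<^sup>2)
      + T k * fps_const (2 * k) * fps_X + T k * fps_X * fps_X"
  proof -
    have "fps_const (k\<^sup>2 - kc\<^sup>2) = fps_const k * fps_const k - fps_const (kc\<^sup>2)"
      "fps_const (2 * k) = fps_const k + fps_const k"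
      by (simp_all add: power2_eq_square)
    then show ?thesis unfolding H_def power2_eq_square by algebra
  qed
  then show ?thesis by (cases n) (simp_all add: algebra_simps)
qed

lemma is_jet_H: "is_jet H"
proof -
  have "is_jet (\<lambda>k. fps_const 1 +
      T k * ((fps_const k + fps_X) * (fps_const k + fps_X) - fps_const (kc\<^sup>2)) + fps_const (kc\<^sup>2))"
    by (intro is_jet_add is_jet_diff is_jet_mult is_jet_const is_jet_ident is_jet_taylor
        smooth_cutoff)
  then show ?thesis by (simp add: H_def[abs_def] power2_eq_square)
qed

text \<open>The mollified symbol is a convex combination of \<open>k^2\<close> and
  \<open>kc^2\<close> with weight \<open>\<theta> kc k\<close>.\<close>

lemma H_nth_0_ge: "1 + min (k\<^sup>2) (kc\<^sup>2) \<le> H k $ 0"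
proof -
  have "\<theta> kc k * min (k\<^sup>2) (kc\<^sup>2) + (1 - \<theta> kc k) * min (k\<^sup>2) (kc\<^sup>2)
      \<le> \<theta> kc k * k\<^sup>2 + (1 - \<theta> kc k) * kc\<^sup>2"
    using cutoff_nonneg cutoff_le_1 by (intro add_mono mult_left_mono) auto
  then show ?thesis by (simp add: H_nth_0 mollified_symbol_def algebra_simps)
qed

lemma H_nth_0_pos: "0 < H k $ 0"
proof -
  have "0 \<le> min (k\<^sup>2) (kc\<^sup>2)" by simp
  then show ?thesis using H_nth_0_ge[of k] by linarith
qed

lemma abs_H_nth_le:
  assumes "n > 0" shows "\<bar>H k $ n\<bar> \<le> symbol_bound C n * H k $ 0"
proof -
  obtain m where n: "n = Suc m" using assms by (cases n) auto
  have H1: "1 \<le> H k $ 0" using H_nth_0_ge[of k] by (smt (verit) zero_le_power2)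
  have Hk: "1 + k\<^sup>2 \<le> H k $ 0" if "\<bar>k\<bar> \<le> 3 / 4 * kc"
  proof -
    have "k\<^sup>2 \<le> kc\<^sup>2" using that kc_pos by (intro power2_le_iff_abs_le[THEN iffD2]) auto
    then show ?thesis using H_nth_0_ge[of k] by simp
  qed
  \<comment> \<open>Where the coefficient is nonzero, \<open>kc^2\<close> is at most
    \<open>4 * k^2\<close>, so the difference is at most \<open>3 * k^2\<close>.\<close>
  have 1: "\<bar>T k $ n * (k\<^sup>2 - kc\<^sup>2)\<bar> \<le> C n * (3 * H k $ 0)"
  proof (cases "T k $ n = 0")
    case True
    then show ?thesis using C_nonneg H1 by simp
  next
    case False
    then have k: "kc / 2 \<le> \<bar>k\<bar>" "\<bar>k\<bar> \<le> 3 / 4 * kc"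
      using T_eq_0_outer[of k n] T_eq_0_inner[of k n] assms by fastforce+
    have "(kc / 2)\<^sup>2 \<le> \<bar>k\<bar>\<^sup>2" using k(1) kc_pos by (intro power_mono) auto
    moreover have "\<bar>k\<bar>\<^sup>2 \<le> kc\<^sup>2" using k(2) kc_pos by (intro power_mono) auto
    ultimately have "\<bar>k\<^sup>2 - kc\<^sup>2\<bar> \<le> 3 * H k $ 0"
      using Hk[OF k(2)] by (simp add: power_divide)
    then show ?thesis
      unfolding abs_mult using abs_T_le C_nonneg by (intro mult_mono) auto
  qed
  \<comment> \<open>Here \<open>m\<close> may be 0, so only the outer vanishing is available; it
    still gives \<open>1 + k^2\<close> as a lower bound for \<open>H k $ 0\<close>.\<close>
  have 2: "\<bar>T k $ m * (2 * k)\<bar> \<le> C m * H k $ 0"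
  proof (cases "T k $ m = 0")
    case True
    then show ?thesis using C_nonneg H1 by simp
  next
    case False
    then have "1 + k\<^sup>2 \<le> H k $ 0"
      using T_eq_0_outer[of k m] by (intro Hk) fastforce
    moreover have "0 \<le> (\<bar>k\<bar> - 1)\<^sup>2" by simp
    then have "\<bar>2 * k\<bar> \<le> 1 + k\<^sup>2" by (simp add: power2_diff abs_mult)
    ultimately show ?thesis
      unfolding abs_mult[of "T k $ m"] using abs_T_le C_nonneg by (intro mult_mono) auto
  qed
  have 3: "\<bar>if m = 0 then 0 else T k $ (m - 1)\<bar> \<le> C (m - 1) * H k $ 0"
    using mult_mono[OF abs_T_le[of k "m - 1"] H1] C_nonneg H1 by auto
  show ?thesis
    unfolding n H_nth_Suc symbol_bound_def using 1 2 3 n by (simp add: algebra_simps)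
qed

definition G :: "real \<Rightarrow> real fps" where "G k = inverse (H k)"

lemma G_nth_0: "G k $ 0 = 1 / (1 + mollified_symbol \<theta> kc k)"
  by (simp add: G_def H_nth_0 inverse_eq_divide)

lemma is_jet_G: "is_jet G"
  unfolding G_def[abs_def] using H_nth_0_pos by (intro is_jet_inverse is_jet_H) (metis less_irrefl)

lemma G_eq_const: "3 / 4 * kc \<le> \<bar>k\<bar> \<Longrightarrow> G k $ 0 = 1 / (1 + kc\<^sup>2)"
  by (simp add: G_nth_0 mollified_symbol_def cutoff_eq_0)

text \<open>The samples \<open>y\<close> lie within \<open>2 * pi * m\<close> of \<open>k\<close>,
  which costs the factor \<open>2 * (1 + (2 * pi * m)^2)\<close> in passing from
  \<open>1 + y^2\<close> to \<open>1 + k^2\<close>. As \<open>y\<close> may exceed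
  \<open>kc\<close>, where \<open>H\<close> grows no further, \<open>1 + k^2\<close> is also
  compared with \<open>1 + kc^2\<close>.\<close>

lemma abs_fdiff_G_le:
  assumes "0 \<le> h" "h \<le> 2 * pi" "\<bar>k\<bar> \<le> kc"
  shows "\<bar>(fdiff h ^^ m) (\<lambda>k. G k $ 0) k\<bar>
    \<le> h ^ m * (fact m * inverse_bound (symbol_bound C) m * (2 * (1 + (2 * pi * m)\<^sup>2))) / (1 + k\<^sup>2)"
proof -
  let ?b = "inverse_bound (symbol_bound C) m"
  have G_le: "\<bar>G y $ m\<bar> \<le> ?b / H y $ 0" for y
    unfolding G_def using H_nth_0_pos abs_H_nth_le by (intro abs_fps_inverse_nth_le) auto
  have "0 \<le> ?b / H 0 $ 0" using G_le[of 0] by linarith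
  then have b: "0 \<le> ?b" using H_nth_0_pos[of 0] by (simp add: zero_le_divide_iff)
  have "\<bar>G y $ m\<bar> \<le> ?b * (2 * (1 + (2 * pi * m)\<^sup>2)) / (1 + k\<^sup>2)"
    if y: "k \<le> y" "y \<le> k + m * h" for y
  proof -
    let ?S = "2 * pi * m"
    have "1 + k\<^sup>2 \<le> 2 * (1 + ?S\<^sup>2) * (1 + y\<^sup>2)"
    proof -
      have "m * h \<le> m * (2 * pi)" using assms(2) by (intro mult_left_mono) auto
      then have "\<bar>k\<bar> \<le> \<bar>y\<bar> + ?S" using y by (simp add: mult_ac)
      then have "\<bar>k\<bar>\<^sup>2 \<le> (\<bar>y\<bar> + ?S)\<^sup>2" by (intro power_mono) auto
      also have "\<dots> \<le> 2 * \<bar>y\<bar>\<^sup>2 + 2 * ?S\<^sup>2"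
        using zero_le_power2[of "\<bar>y\<bar> - ?S"] by (simp only: power2_sum power2_diff)
      finally have "1 + k\<^sup>2 \<le> 2 * (1 + ?S\<^sup>2 + y\<^sup>2)" by simp
      also have "\<dots> \<le> 2 * ((1 + ?S\<^sup>2) * (1 + y\<^sup>2))"
        by (intro mult_left_mono) (simp_all add: ring_distribs)
      finally show ?thesis by (simp only: mult.assoc)
    qed
    moreover have "1 + k\<^sup>2 \<le> 2 * (1 + ?S\<^sup>2) * (1 + kc\<^sup>2)"
    proof -
      have "k\<^sup>2 \<le> kc\<^sup>2" using assms(3) kc_pos by (intro power2_le_iff_abs_le[THEN iffD2]) auto
      then have "1 + k\<^sup>2 \<le> 1 * (1 + kc\<^sup>2)" by simp
      also have "\<dots> \<le> 2 * (1 + ?S\<^sup>2) * (1 + kc\<^sup>2)"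
        by (intro mult_right_mono) (auto simp: ring_distribs)
      finally show ?thesis .
    qed
    ultimately have "1 + k\<^sup>2 \<le> 2 * (1 + ?S\<^sup>2) * (1 + min (y\<^sup>2) (kc\<^sup>2))"
      by (simp add: min_def)
    also have "\<dots> \<le> 2 * (1 + ?S\<^sup>2) * H y $ 0"
      using H_nth_0_ge by (intro mult_left_mono) auto
    finally have "?b * (1 + k\<^sup>2) \<le> ?b * (2 * (1 + ?S\<^sup>2) * H y $ 0)"
      using b by (intro mult_left_mono)
    moreover have "0 < 1 + k\<^sup>2" by (simp add: add_pos_nonneg)
    ultimately have "?b / H y $ 0 \<le> ?b * (2 * (1 + ?S\<^sup>2)) / (1 + k\<^sup>2)"
      using H_nth_0_pos[of y] by (simp only: pos_le_divide_eq pos_divide_le_eq mult_ac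
          times_divide_eq_left times_divide_eq_right)
    then show ?thesis using G_le[of y] by linarith
  qed
  from abs_funpow_fdiff_le[OF is_jet_G assms(1), of k m, OF this]
  show ?thesis by (simp add: mult_ac)
qed

end

section \<open>Weighted norms of an inverse discrete Fourier transform\<close>

text \<open>The modulus is \<open>2 * sin u\<close> with \<open>u = pi * x / L\<close>. The chord
  bound for sine applies to \<open>u\<close> on the first half of the circle and to
  \<open>pi - u\<close> on the second.\<close>

lemma dist0_le_cis:
  assumes "0 \<le> x" "x < L"
  shows "dist0 L x \<le> L / 4 * cmod (cis (- (dk L * x)) - 1)"
proof -
  define u where "u = pi * x / L"
  have u: "0 \<le> u" "u \<le> pi" using assms by (auto simp: u_def divide_simps)
  have "cmod (cis (- (dk L * x)) - 1) = 2 * \<bar>sin (- (dk L * x) / 2)\<bar>"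
    unfolding cis_conv_exp by (rule dist_exp_i_1)
  also have "- (dk L * x) / 2 = - u" by (simp add: dk_def u_def)
  also have "\<bar>sin (- u)\<bar> = sin u" using u sin_ge_zero by simp
  finally have "cmod (cis (- (dk L * x)) - 1) = 2 * sin u" .
  moreover have "2 * dist0 L x / L \<le> sin u"
  proof (cases "x < L / 2")
    case True
    then have "2 * u / pi \<le> sin u"
      using assms u(1) by (intro sin_ge_chord) (auto simp: u_def field_simps)
    then show ?thesis using True by (simp add: u_def dist0_def)
  next
    case False
    then have "2 * (pi - u) / pi \<le> sin (pi - u)"
      using assms u(2) by (intro sin_ge_chord) (auto simp: u_def field_simps)
    moreover have "2 * (pi - u) / pi = 2 * dist0 L x / L"
      using assms False by (simp add: u_def dist0_def field_simps)
    ultimately show ?thesis by simp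
  qed
  ultimately show ?thesis using assms by (simp add: field_simps)
qed

text \<open>Each weight is traded for a forward difference in frequency. \<open>bd\<close> is the
  endpoint agreement that the summation by parts requires at each of the \<open>m\<close> stages;
  Parseval concludes.\<close>

lemma lattice_norm_dist0_le:
  fixes f :: "real \<Rightarrow> real"
  assumes "L > 0" "N > 0" "even N"
    and a: "a = - int (N div 2) + 1"
    and f: "\<And>k. k \<in> freq_grid L N \<Longrightarrow> fhat k = of_real (f k)"
    and g: "\<And>x. x \<in> space_grid L N \<Longrightarrow> g x = inverse_dft L N fhat x"
    and bd: "\<And>j. j < m \<Longrightarrow>
      (fdiff (dk L) ^^ j) f ((a + int N) * dk L) = (fdiff (dk L) ^^ j) f (a * dk L)"
  shows "(lattice_norm L N (\<lambda>x. of_real (dist0 L x ^ m) * g x))\<^sup>2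
    \<le> (L / 4) ^ (2 * m) / L * (\<Sum>n\<in>{a..<a + int N}. ((fdiff (dk L) ^^ m) f (n * dk L))\<^sup>2)"
proof -
  let ?A = "{a..<a + int N}"
  \<comment> \<open>\<open>D j\<close> is not taken periodic: it uses values of \<open>f\<close>
    beyond the frequency grid. \<open>S 0 i\<close> is \<open>L\<close> times \<open>g\<close> at
    the \<open>i\<close>-th node.\<close>
  define D where "D j n = complex_of_real ((fdiff (dk L) ^^ j) f (of_int n * dk L))" for j n
  define S where "S j i = (\<Sum>n\<in>?A. cis (2 * pi * of_int n * real i / N) * D j n)"
    for j and i :: nat
  have dx: "dx L N > 0" using assms by (simp add: dx_def)
  have dk: "dk L > 0" using assms by (simp add: dk_def)
  have phase: "dk L * (real i * dx L N) = 2 * pi * i / N" for i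
    using assms by (simp add: dk_def dx_def)
  have g_eq: "g (real i * dx L N) = S 0 i / L" if "i < N" for i
  proof -
    have A: "{- int (N div 2) + 1..int (N div 2)} = ?A"
      using \<open>even N\<close> unfolding a by (auto elim!: evenE)
    have "g (real i * dx L N) = inverse_dft L N fhat (real i * dx L N)"
      using that by (intro g) (auto simp: space_grid_def)
    also have "\<dots> = 1 / of_real L *
        (\<Sum>k\<in>freq_grid L N. exp (\<i> * of_real (k * (real i * dx L N))) * of_real (f k))"
      unfolding inverse_dft_def by (simp add: f)
    also have "(\<Sum>k\<in>freq_grid L N. exp (\<i> * of_real (k * (real i * dx L N))) * of_real (f k))
        = (\<Sum>n\<in>?A. exp (\<i> * of_real (of_int n * dk L * (real i * dx L N)))
            * of_real (f (of_int n * dk L)))"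
      unfolding freq_grid_def A using dk by (subst sum.reindex) (auto simp: inj_on_def)
    also have "\<dots> = S 0 i"
      unfolding S_def D_def
      by (intro sum.cong refl) (simp add: mult.assoc phase cis_conv_exp, simp add: mult_ac)
    finally show ?thesis by simp
  qed
  have S: "(cis (- (2 * pi * i / N)) - 1) ^ j * S 0 i = S j i" if "j \<le> m" for i j
    using that
  proof (induction j)
    case (Suc j)
    let ?t = "2 * pi * i / N"
    have "cis (N * ?t) = 1" using assms(2) cis_multiple_2pi[of "real i"] by simp
    then have "(cis (- ?t) - 1) * (\<Sum>n\<in>?A. cis (n * ?t) * D j n)
        = (\<Sum>n\<in>?A. cis (n * ?t) * (D j (n + 1) - D j n))"
      using bd[of j] Suc.prems by (intro summation_by_parts_cis) (simp_all add: D_def)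
    moreover have "D j (n + 1) - D j n = D (Suc j) n" for n
      unfolding D_def funpow_fdiff_Suc by (simp add: ring_distribs)
    ultimately have "(cis (- ?t) - 1) * S j i = S (Suc j) i"
      by (simp add: S_def mult_ac)
    then show ?case using Suc by (simp only: power_Suc mult.assoc Suc_leD)
  qed simp
  have pt: "(cmod (of_real (dist0 L x ^ m) * g x))\<^sup>2 \<le> (L / 4) ^ (2 * m) / L\<^sup>2 * (cmod (S m i))\<^sup>2"
    if i: "i < N" and x: "x = real i * dx L N" for x i
  proof -
    have "real i * L < real N * L" using i assms by simp
    then have xL: "0 \<le> x" "x < L" using i assms by (auto simp: x dx_def field_simps)
    let ?w = "cis (- (2 * pi * i / N)) - 1"
    have "dist0 L x \<le> L / 4 * cmod ?w"
      using dist0_le_cis[OF xL] by (simp only: x phase)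
    moreover have "0 \<le> dist0 L x" using xL by (simp add: dist0_def)
    ultimately have "dist0 L x ^ m \<le> (L / 4 * cmod ?w) ^ m" by (intro power_mono)
    then have "dist0 L x ^ m * cmod (g x) \<le> (L / 4 * cmod ?w) ^ m * cmod (g x)"
      by (intro mult_right_mono) auto
    also have "\<dots> = (L / 4) ^ m * cmod (?w ^ m * S 0 i) / L"
      unfolding power_mult_distrib
      using assms(1) by (simp add: x g_eq i norm_mult norm_divide norm_power)
    also have "\<dots> = (L / 4) ^ m / L * cmod (S m i)" by (simp add: S)
    finally have "(dist0 L x ^ m * cmod (g x))\<^sup>2 \<le> ((L / 4) ^ m / L * cmod (S m i))\<^sup>2"
      using \<open>0 \<le> dist0 L x\<close> by (intro power_mono) auto
    then show ?thesis
      using \<open>0 \<le> dist0 L x\<close>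
      by (simp add: norm_mult norm_power power_mult_distrib power_divide power_mult[symmetric]
          mult.commute[of 2])
  qed
  have inj: "inj_on (\<lambda>i. real i * dx L N) {..<N}" using dx by (auto simp: inj_on_def)
  have "(lattice_norm L N (\<lambda>x. of_real (dist0 L x ^ m) * g x))\<^sup>2
      = dx L N * (\<Sum>x\<in>space_grid L N. (cmod (of_real (dist0 L x ^ m) * g x))\<^sup>2)"
    unfolding lattice_norm_def using dx by (intro real_sqrt_pow2 mult_nonneg_nonneg sum_nonneg) auto
  also have "\<dots> \<le> dx L N * (\<Sum>i<N. (L / 4) ^ (2 * m) / L\<^sup>2 * (cmod (S m i))\<^sup>2)"
    unfolding space_grid_def atLeast0LessThan sum.reindex[OF inj] o_def
    using dx pt by (intro mult_left_mono sum_mono) auto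
  also have "\<dots> = dx L N * ((L / 4) ^ (2 * m) / L\<^sup>2 * (N * (\<Sum>n\<in>?A. (cmod (D m n))\<^sup>2)))"
    unfolding S_def by (simp only: discrete_parseval[OF assms(2)] flip: sum_distrib_left)
  \<comment> \<open>The \<open>N\<close> from Parseval and the mesh width multiply to
    \<open>L\<close>.\<close>
  also have "\<dots> = (L / 4) ^ (2 * m) / L * (\<Sum>n\<in>?A. (cmod (D m n))\<^sup>2)"
    using assms(1,2) by (simp add: dx_def power2_eq_square)
  finally show ?thesis by (simp add: D_def del: funpow.simps)
qed

theorem theorem3p5:
  fixes C\<theta> :: "nat \<Rightarrow> real"
  shows "\<exists>Cg :: nat \<Rightarrow> real.
    \<forall>\<theta> :: real \<Rightarrow> real \<Rightarrow> real. admissible_cutoffs C\<theta> \<theta> \<longrightarrow>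
      (\<forall>(L :: real) (N :: nat) (g :: real \<Rightarrow> complex) (ghat :: real \<Rightarrow> complex).
        L \<ge> 1 \<longrightarrow> N \<ge> 32 \<longrightarrow> even N \<longrightarrow> dx L N \<le> 1 \<longrightarrow>
        (\<forall>k\<in>freq_grid L N.
           (1 + of_real (mollified_symbol \<theta> (cutoff_freq L N) k)) * ghat k = -1) \<longrightarrow>
        (\<forall>x\<in>space_grid L N. g x = inverse_dft L N ghat x) \<longrightarrow>
        (\<forall>m :: nat. real m \<le> real N / 16 \<longrightarrow>
           lattice_norm L N (\<lambda>x. of_real (dist0 L x ^ m) * g x) \<le> Cg m))"
proof -
  define E where
    "E m = fact m * inverse_bound (symbol_bound C\<theta>) m * (2 * (1 + (2 * pi * m)\<^sup>2))" for m :: nat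
  \<comment> \<open>\<open>pi / 2\<close> is \<open>L / 4\<close> times the frequency step,
    \<open>E m\<close> comes from \<open>abs_fdiff_G_le\<close>, and 2 is the root of the bound 4
    for the remaining sum.\<close>
  have "lattice_norm L N (\<lambda>x. of_real (dist0 L x ^ m) * g x) \<le> (pi / 2) ^ m * \<bar>E m\<bar> * 2"
    if adm: "admissible_cutoffs C\<theta> \<theta>" and L: "L \<ge> 1" and N: "N \<ge> 32" "even N" and dx1: "dx L N \<le> 1"
      and ghat: "\<forall>k\<in>freq_grid L N.
        (1 + of_real (mollified_symbol \<theta> (cutoff_freq L N) k)) * ghat k = -1"
      and g: "\<forall>x\<in>space_grid L N. g x = inverse_dft L N ghat x"
      and m: "real m \<le> real N / 16"
    for \<theta> L N g ghat and m :: nat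
  proof -
    define kc where "kc = cutoff_freq L N"
    have "dx L N > 0" using L N by (simp add: dx_def)
    then have "pi \<le> kc" using dx1 by (simp add: kc_def cutoff_freq_def pos_le_divide_eq)
    then interpret cutoff C\<theta> \<theta> kc
      using adm by unfold_locales
    define K where "K = N div 2"
    have NK: "N = 2 * K" using N by (auto simp: K_def)
    define h where "h = dk L"
    have h: "0 < h" "h \<le> 2 * pi" using L by (auto simp: h_def dk_def divide_simps)
    have kcK: "kc = K * h"
      using L N by (simp add: kc_def cutoff_freq_def dx_def h_def dk_def NK)
    define a where "a = - int (N div 2) + 1"
    have a_eq: "a = - int K + 1" by (simp add: a_def K_def)
    \<comment> \<open>\<open>f\<close> extends \<open>ghat\<close> to all real frequencies, so that
      differences may leave the grid.\<close>
    define f where "f k = - (G k $ 0)" for k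
    have fhat: "ghat k = of_real (f k)" if "k \<in> freq_grid L N" for k
    proof -
      have "1 + mollified_symbol \<theta> kc k \<noteq> 0" using H_nth_0_pos[of k] by (simp add: H_nth_0)
      then have "1 + complex_of_real (mollified_symbol \<theta> kc k) \<noteq> 0"
        by (metis of_real_1 of_real_add of_real_eq_0_iff)
      then have "ghat k = - 1 / (1 + of_real (mollified_symbol \<theta> kc k))"
        using bspec[OF ghat that] by (simp only: kc_def eq_divide_eq mult.commute) simp
      then show ?thesis by (simp add: f_def G_nth_0)
    qed
    have fdiff_f: "(fdiff h ^^ j) f = (\<lambda>k. - (fdiff h ^^ j) (\<lambda>k. G k $ 0) k)" for j
      by (induction j) (auto simp: f_def fdiff_def)
    have "(fdiff h ^^ j) f ((a + int N) * h) = (fdiff h ^^ j) f (a * h)" if "j < m" for j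
    proof -
      \<comment> \<open>The 1 accounts for the grid starting at \<open>- K + 1\<close>. The left
        samples then stay below \<open>- (3 / 4 * kc)\<close> and the right ones above
        \<open>3 / 4 * kc\<close>, where \<open>f\<close> has the same constant value.\<close>
      have "real j + 1 \<le> K / 4" using that m by (simp add: NK)
      then have "(of_int a + j) * h \<le> (- (3 / 4 * K)) * h"
        using h by (intro mult_right_mono) (auto simp: a_eq)
      then have le: "of_int a * h + j * h \<le> - (3 / 4 * kc)"
        by (simp add: kcK algebra_simps)
      have ge: "3 / 4 * kc \<le> of_int (a + int N) * h"
        unfolding kcK mult.assoc[symmetric] using h by (intro mult_right_mono) (auto simp: a_eq NK)
      have "(fdiff h ^^ j) f (of_int a * h) =
          (if j = 0 then - (1 / (1 + kc\<^sup>2)) else 0)"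
        using h le kc_pos by (intro funpow_fdiff_const) (auto simp: f_def G_eq_const)
      moreover have "(fdiff h ^^ j) f (of_int (a + int N) * h) =
          (if j = 0 then - (1 / (1 + kc\<^sup>2)) else 0)"
        using h ge kc_pos by (intro funpow_fdiff_const) (auto simp: f_def G_eq_const)
      ultimately show ?thesis by simp
    qed
    then have "(lattice_norm L N (\<lambda>x. of_real (dist0 L x ^ m) * g x))\<^sup>2
        \<le> (L / 4) ^ (2 * m) / L * (\<Sum>n\<in>{a..<a + int N}. ((fdiff h ^^ m) f (n * h))\<^sup>2)"
      using L N g fhat unfolding h_def
      by (intro lattice_norm_dist0_le[where fhat = ghat]) (auto simp: a_def)
    \<comment> \<open>Squaring gives two factors \<open>1 / (1 + (n * h)^2)\<close>; one is dropped.
      The inserted \<open>h / h\<close> produces the Riemann sum of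
      \<open>sum_le_arctan\<close>.\<close>
    also have "\<dots> \<le> (L / 4) ^ (2 * m) / L *
        (\<Sum>n\<in>{a..<a + int N}. (h ^ m * E m)\<^sup>2 / h * (h / (1 + (n * h)\<^sup>2)))"
    proof (intro mult_left_mono sum_mono)
      fix n assume n: "n \<in> {a..<a + int N}"
      have pos: "1 \<le> 1 + (of_int n * h)\<^sup>2" by simp
      have "\<bar>of_int n\<bar> * h \<le> K * h"
        using n h by (intro mult_right_mono) (auto simp: a_eq NK)
      then have "\<bar>of_int n * h\<bar> \<le> kc" using h by (simp add: kcK abs_mult)
      then have "\<bar>(fdiff h ^^ m) f (n * h)\<bar> \<le> h ^ m * E m / (1 + (n * h)\<^sup>2)"
        unfolding fdiff_f E_def using abs_fdiff_G_le[of h "of_int n * h" m] h by simp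
      then have "((fdiff h ^^ m) f (n * h))\<^sup>2 \<le> (h ^ m * E m / (1 + (n * h)\<^sup>2))\<^sup>2"
        by (metis abs_ge_zero power2_abs power_mono)
      also have "\<dots> = (h ^ m * E m)\<^sup>2 / (1 + (n * h)\<^sup>2) ^ 2" by (simp add: power_divide)
      also have "\<dots> \<le> (h ^ m * E m)\<^sup>2 / (1 + (n * h)\<^sup>2) ^ 1"
        using pos by (intro divide_left_mono power_increasing) (auto intro!: mult_pos_pos zero_less_power add_pos_nonneg)
      finally show "((fdiff h ^^ m) f (n * h))\<^sup>2 \<le> (h ^ m * E m)\<^sup>2 / h * (h / (1 + (n * h)\<^sup>2))"
        using h by simp
    qed (use L in auto)
    also have "\<dots> = (L / 4) ^ (2 * m) / L * ((h ^ m * E m)\<^sup>2 / h) *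
        (\<Sum>n\<in>{a..<a + int N}. h / (1 + (n * h)\<^sup>2))"
      by (simp only: mult.assoc flip: sum_distrib_left)
    also have "\<dots> \<le> (L / 4) ^ (2 * m) / L * ((h ^ m * E m)\<^sup>2 / h) * (h + pi)"
    proof (rule mult_left_mono)
      have "(\<Sum>n\<in>{a..<a + int N}. h / (1 + (n * h)\<^sup>2))
          \<le> (\<Sum>n\<in>{- int K..int K}. h / (1 + (n * h)\<^sup>2))"
        using h by (intro sum_mono2) (auto simp: a_eq NK)
      also have "\<dots> \<le> h + 2 * arctan (K * h)" by (rule sum_le_arctan[OF h(1)])
      also have "\<dots> \<le> h + pi" using arctan_bounded[of "K * h"] by simp
      finally show "(\<Sum>n\<in>{a..<a + int N}. h / (1 + (n * h)\<^sup>2)) \<le> h + pi" .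
    qed (use L h in auto)
    also have "\<dots> = (L / 4 * h) ^ (2 * m) * (E m)\<^sup>2 * ((h + pi) / (L * h))"
      unfolding power_mult_distrib by (simp add: power_mult[symmetric] mult.commute[of 2])
    \<comment> \<open>Since \<open>L * h = 2 * pi\<close> and \<open>h\<close> is at most
      \<open>2 * pi\<close>, the quotient is at most 3/2; 4 is a convenient square above it.\<close>
    also have "\<dots> \<le> (L / 4 * h) ^ (2 * m) * (E m)\<^sup>2 * 4"
      using L h by (intro mult_left_mono) (auto simp: h_def dk_def field_simps)
    also have "L / 4 * h = pi / 2" using L by (simp add: h_def dk_def)
    also have "(pi / 2) ^ (2 * m) * (E m)\<^sup>2 * 4 = ((pi / 2) ^ m * \<bar>E m\<bar> * 2)\<^sup>2"
      by (simp add: power_mult_distrib power_mult[symmetric] mult.commute[of 2])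
    finally show ?thesis by (rule power2_le_imp_le) simp
  qed
  then show ?thesis
    by (intro exI[of _ "\<lambda>m. (pi / 2) ^ m * \<bar>E m\<bar> * 2"]) blast
qed

end
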